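(* Let $\mathcal{X}$ be a second-countable locally compact Hausdorff space. Let $r,k\ge1$ be integers and let $\varphi_r:\mathcal{X}^r\to\mathbb{R}$ be a compactly supported, bounded and measurable function. Let $\mathcal{P}_n,\mathcal{Q}_n$ be sequences of random point processes such that $\mathcal{P}_n$ is weakly coherent with $\mathcal{Q}_n$ with rate $N(\delta,\varepsilon,\cdot)$. Then there exist a finite family of compactly supported, bounded and measurable functions $(\varphi^i)_{i=1}^L$, $\varphi^i:\mathcal{X}^{r_i}\to\mathbb{R}$, depending on $\varphi_r$ (and $k$), and a constant $s>0$, such that for all $\delta\in(0,1)$ and $\varepsilon>0$, $$n\ge\max_{i=1,\dots,L}N\Big(\frac{\delta}{L},\frac{\varepsilon}{s},\varphi^i\Big)\ \Rightarrow\ \mathbb{P}\Big(\big|m_k^{(\varphi_r)}(\mathcal{P}_n)-m_k^{(\varphi_r)}(\mathcal{Q}_n)\big|\ge\varepsilon\Big)\le\delta.$$ In addition, if each of the moments $m_j^{(\varphi_r)}(\mathcal{Q}_n)$ is uniformly bounded in $n$ with probability $1$, the same result holds for the central moments $\overline{m}_k^{(\varphi_r)}$ in place of $m_k^{(\varphi_r)}$, with a different constant $\overline{s}$.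
   Context: A (simple) point process on a second-countable locally compact Hausdorff space is a probability distribution over its locally finite subsets (those having finite intersection with every compact set). A random point process is a random variable whose values are point processes; $\mathbb{P}$ refers to this randomness (that of $\mathcal{P}_n$ and $\mathcal{Q}_n$ themselves), while $\mathbf{E}_{\mathcal{S}\sim\mathcal{P}}$ refers to sampling $\mathcal{S}$ from a given process $\mathcal{P}$. Here $\mathcal{P}_n$ and $\mathcal{Q}_n$ are point processes over subspaces $\mathcal{X}_n\subset\mathcal{X}$ and $\mathcal{Y}_n\subset\mathcal{X}$, not necessarily determinantal. For bounded measurable $\varphi_r:\mathcal{X}^r\to\mathbb{R}$, $\Lambda^{(\varphi_r)}(\mathcal{S})=\sum\varphi_r(y_1,\dots,y_r)$, summed over $r$-tuples of pairwise distinct points of $\mathcal{S}$, and $\Phi^{(\varphi_r)}(\mathcal{P})=\mathbf{E}_{\mathcal{S}\sim\mathcal{P}}[\Lambda^{(\varphi_r)}(\mathcal{S})]$. The raw and central moments are $m_k^{(\varphi_r)}(\mathcal{P})=\mathbf{E}_{\mathcal{S}\sim\mathcal{P}}[\Lambda^{(\varphi_r)}(\mathcal{S})^k]$ and $\overline{m}_k^{(\varphi_r)}(\mathcal{P})=\mathbf{E}_{\mathcal{S}\sim\mathcal{P}}[(\Lambda^{(\varphi_r)}(\mathcal{S})-m_1^{(\varphi_r)}(\mathcal{P}))^k]$. Weak coherency: $\mathcal{P}_n$ is weakly coherent with $\mathcal{Q}_n$, with rate $N$, if for all $r\ge1$, all compactly supported, bounded, measurable $\psi:\mathcal{X}^r\to\mathbb{R}$,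 all $\delta\in(0,1)$ and $\varepsilon>0$, $N(\delta,\varepsilon,\psi)$ is such that $n\ge N(\delta,\varepsilon,\psi)\Rightarrow\mathbb{P}(|\Phi^{(\psi)}(\mathcal{P}_n)-\Phi^{(\psi)}(\mathcal{Q}_n)|\ge\varepsilon)\le\delta$. *)

theory Defs
  imports "HOL-Probability.Probability"
begin

text \<open>
  Points of \<open>X\<^sup>r\<close> are extensional functions on \<open>{..<r}\<close>. As \<open>X\<close> is second countable, the Borel
  sets of \<open>X\<^sup>r\<close> are those of the product sigma-algebra. The values of \<open>\<psi>\<close> at functions that are
  not extensional on \<open>{..<r}\<close> are irrelevant.
\<close>

abbreviation tuple_topology :: "nat \<Rightarrow> (nat \<Rightarrow> 'a::topological_space) topology" where
  "tuple_topology r \<equiv> product_topology (\<lambda>_. euclidean) {..<r}"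

definition test_function :: "nat \<Rightarrow> ((nat \<Rightarrow> 'a::topological_space) \<Rightarrow> real) \<Rightarrow> bool" where
  "test_function r \<psi> \<longleftrightarrow>
     \<psi> \<in> borel_measurable (Pi\<^sub>M {..<r} (\<lambda>_. borel)) \<and>
     bounded (\<psi> ` ({..<r} \<rightarrow>\<^sub>E UNIV)) \<and>
     compactin (tuple_topology r)
       (tuple_topology r closure_of {x \<in> {..<r} \<rightarrow>\<^sub>E UNIV. \<psi> x \<noteq> 0})"

text \<open>
  Configurations in a subspace \<open>A\<close> of the ambient space. Local finiteness refers to the compact
  sets of the ambient space, so that sums over a configuration of a function compactly supported
  in the ambient space are finite; for closed \<open>A\<close> this agrees with local finiteness in \<open>A\<close>.
\<close>

definition locally_finite_subsets :: "'a::topological_space set \<Rightarrow> 'a set set" where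
  "locally_finite_subsets A = {S. S \<subseteq> A \<and> (\<forall>K. compact K \<longrightarrow> finite (S \<inter> K))}"

text \<open>
  The usual sigma-algebra on configurations, generated by the numbers of points in relatively
  compact Borel sets (these numbers are finite, so \<open>card\<close> is the true cardinality).
\<close>

definition configuration_space :: "'a::topological_space set \<Rightarrow> 'a set measure" where
  "configuration_space A =
     sigma (locally_finite_subsets A)
       {{S \<in> locally_finite_subsets A. card (S \<inter> B) = m} | B m.
          B \<in> sets borel \<and> compact (closure B)}"

definition point_process :: "'a::topological_space set \<Rightarrow> 'a set measure \<Rightarrow> bool" where
  "point_process A P \<longleftrightarrow> P \<in> space (prob_algebra (configuration_space A))"

text \<open>
  A random point process is a random variable in the space of point processes: by definition of
  \<open>prob_algebra\<close>, its values satisfy \<open>point_process A\<close> at every sample point.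
\<close>

definition random_point_process ::
    "'w measure \<Rightarrow> 'a::topological_space set \<Rightarrow> ('w \<Rightarrow> 'a set measure) \<Rightarrow> bool" where
  "random_point_process \<Omega> A P \<longleftrightarrow> P \<in> \<Omega> \<rightarrow>\<^sub>M prob_algebra (configuration_space A)"

lemma random_point_processD:
  "random_point_process \<Omega> A P \<Longrightarrow> \<omega> \<in> space \<Omega> \<Longrightarrow> point_process A (P \<omega>)"
  unfolding random_point_process_def point_process_def by (rule measurable_space)

text \<open>
  The index set may be infinite, hence \<open>infsum\<close>; for test functions and locally finite \<open>S\<close> only
  finitely many terms are nonzero.
\<close>

definition linear_statistic :: "nat \<Rightarrow> ((nat \<Rightarrow> 'a) \<Rightarrow> real) \<Rightarrow> 'a set \<Rightarrow> real" where
  "linear_statistic r \<psi> S = (\<Sum>\<^sub>\<infinity>x\<in>{x \<in> {..<r} \<rightarrow>\<^sub>E S. inj_on x {..<r}}. \<psi> x)"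

definition mean_statistic :: "nat \<Rightarrow> ((nat \<Rightarrow> 'a) \<Rightarrow> real) \<Rightarrow> 'a set measure \<Rightarrow> real" where
  "mean_statistic r \<psi> P = (\<integral>S. linear_statistic r \<psi> S \<partial>P)"

definition raw_moment :: "nat \<Rightarrow> ((nat \<Rightarrow> 'a) \<Rightarrow> real) \<Rightarrow> nat \<Rightarrow> 'a set measure \<Rightarrow> real" where
  "raw_moment r \<psi> k P = (\<integral>S. linear_statistic r \<psi> S ^ k \<partial>P)"

definition central_moment :: "nat \<Rightarrow> ((nat \<Rightarrow> 'a) \<Rightarrow> real) \<Rightarrow> nat \<Rightarrow> 'a set measure \<Rightarrow> real" where
  "central_moment r \<psi> k P = (\<integral>S. (linear_statistic r \<psi> S - raw_moment r \<psi> 1 P) ^ k \<partial>P)"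

text \<open>
  The real numbers \<open>mean_statistic r \<psi> (P n \<omega>)\<close> compared in weak coherency are genuine
  expectations. This has to be said explicitly because the Bochner integral of a function that is
  not integrable is \<open>0\<close>.
\<close>

definition expectations_exist ::
    "'w measure \<Rightarrow> (nat \<Rightarrow> 'w \<Rightarrow> 'a::topological_space set measure) \<Rightarrow> bool" where
  "expectations_exist \<Omega> P \<longleftrightarrow>
     (\<forall>n r \<psi>. 1 \<le> r \<longrightarrow> test_function r \<psi> \<longrightarrow>
        (AE \<omega> in \<Omega>. integrable (P n \<omega>) (linear_statistic r \<psi>)))"

text \<open>The arity \<open>r\<close> of \<open>\<psi>\<close> is not determined by its HOL type, so the rate takes it as an argument.\<close>

definition weakly_coherent ::
    "'w measure \<Rightarrow> (nat \<Rightarrow> 'w \<Rightarrow> 'a::topological_space set measure) \<Rightarrow>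
     (nat \<Rightarrow> 'w \<Rightarrow> 'a set measure) \<Rightarrow>
     (real \<Rightarrow> real \<Rightarrow> nat \<Rightarrow> ((nat \<Rightarrow> 'a) \<Rightarrow> real) \<Rightarrow> nat) \<Rightarrow> bool" where
  "weakly_coherent \<Omega> P Q N \<longleftrightarrow>
     (\<forall>r \<psi> \<delta> \<epsilon> n. 1 \<le> r \<longrightarrow> test_function r \<psi> \<longrightarrow> 0 < \<delta> \<longrightarrow> \<delta> < 1 \<longrightarrow> 0 < \<epsilon> \<longrightarrow>
        N \<delta> \<epsilon> r \<psi> \<le> n \<longrightarrow>
        measure \<Omega> {\<omega> \<in> space \<Omega>.
          \<bar>mean_statistic r \<psi> (P n \<omega>) - mean_statistic r \<psi> (Q n \<omega>)\<bar> \<ge> \<epsilon>} \<le> \<delta>)"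

end

theory Submission
  imports Defs
begin

text \<open>
  The idea is that a power of a linear statistic is again a sum of linear statistics. Expanding
  \<open>\<Lambda>\<^sup>j\<close> gives a sum over \<open>j\<close>-tuples of injective \<open>r\<close>-tuples of points of \<open>S\<close>. Different \<open>r\<close>-tuples
  may share points, so the terms are grouped by their pattern of coincidences: a labelling of
  the \<open>j \<cdot> r\<close> positions by \<open>m\<close> labels, injective on each block of \<open>r\<close> positions, together with an
  injective \<open>m\<close>-tuple that says which point each label stands for. Each pattern contributes the
  linear statistic of one function of \<open>m\<close> variables (\<open>linear_statistic_power\<close>), and that function
  is again a test function, because every label is used by some position and so every variable
  is confined to a compact set (\<open>test_function_overlap_function\<close>). Thus every raw moment is a
  fixed finite sum of expectations to which weak coherency applies.

  If weak coherency is used for all these \<open>L\<close> functions at once, with failure probability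
  \<open>\<delta> / L\<close> for each, then outside an event of probability at most \<open>\<delta>\<close> all the raw moments up to a
  given order are close (\<open>weakly_coherent_simultaneously\<close>, \<open>raw_moment_diff_le\<close>).

  The central moment is a polynomial in the raw moments, hence Lipschitz on bounded sets, which
  settles small \<open>\<epsilon>\<close>. One constant \<open>s'\<close> has to serve large \<open>\<epsilon>\<close> too, and there the polynomial bound is
  useless since the degree is in general greater than one. Instead, each central moment is
  dominated by the raw moment of the even order \<open>2k\<close> of the same process, by Jensen's inequality,
  and that moment grows only linearly in the error (\<open>central_moment_diff_le\<close>). For this reason the family of test functions comes from
  the moments of all orders up to \<open>2k\<close> rather than up to \<open>k\<close>.
\<close>

section \<open>Maps factored through labellings\<close>

text \<open>
  Composition with a fixed bijection turns permutations of \<open>{..<m}\<close> into bijections onto \<open>A\<close>.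
\<close>

lemma card_bijections_PiE:
  assumes "finite A" "card A = m"
  shows "card {g \<in> {..<m} \<rightarrow>\<^sub>E A. inj_on g {..<m} \<and> g ` {..<m} = A} = fact m"
proof -
  obtain b where b: "bij_betw b {..<m} A"
    using assms by (metis atLeast0LessThan ex_bij_betw_nat_finite)
  have "bij_betw (\<lambda>p. restrict (b \<circ> p) {..<m}) {p. p permutes {..<m}}
          {g \<in> {..<m} \<rightarrow>\<^sub>E A. inj_on g {..<m} \<and> g ` {..<m} = A}"
  proof (rule bij_betwI[where g = "\<lambda>g i. if i < m then inv_into {..<m} b (g i) else i"],
      goal_cases)
    case 1
    have "bij_betw (b \<circ> p) {..<m} A" if "p permutes {..<m}" for p
      using that b by (meson bij_betw_trans permutes_imp_bij)
    then have "inj_on (b \<circ> p) {..<m} \<and> (b \<circ> p) ` {..<m} = A" if "p permutes {..<m}" for p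
      using that by (auto simp: bij_betw_def)
    then show ?case
      by (simp add: PiE_iff inj_on_restrict_eq image_restrict_eq Pi_iff) blast
  next
    case 2
    show ?case
    proof
      fix g assume g: "g \<in> {g \<in> {..<m} \<rightarrow>\<^sub>E A. inj_on g {..<m} \<and> g ` {..<m} = A}"
      then have "bij_betw g {..<m} A"
        by (auto simp: bij_betw_def)
      then have "bij_betw (inv_into {..<m} b \<circ> g) {..<m} {..<m}"
        using b bij_betw_inv_into bij_betw_trans by blast
      then have "bij_betw (\<lambda>i. if i < m then inv_into {..<m} b (g i) else i) {..<m} {..<m}"
        by (rule bij_betw_cong[THEN iffD1, rotated]) auto
      then show "(\<lambda>i. if i < m then inv_into {..<m} b (g i) else i) \<in> {p. p permutes {..<m}}"
        unfolding mem_Collect_eq by (rule bij_imp_permutes) simp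
    qed
  next
    case (3 p)
    have "inv_into {..<m} b (b (p i)) = p i" if "i < m" for i
      using 3 that b permutes_in_image[of p "{..<m}" i] by (auto simp: bij_betw_def)
    then show ?case
      using 3 by (auto simp: fun_eq_iff permutes_def)
  next
    case (4 g)
    have "b (inv_into {..<m} b (g i)) = g i" if "i < m" for i
      using 4 that b by (intro f_inv_into_f) (auto simp: bij_betw_def)
    then show ?case
      using 4 by (intro ext) (auto simp: PiE_iff extensional_def)
  qed
  from bij_betw_same_card[OF this] show ?thesis
    by (simp add: card_permutations[where n = m])
qed

text \<open>
  Surjectivity makes the labels in use exactly \<open>{..<m}\<close>; up to a renaming of the labels, a labelling
  is a partition of \<open>J\<close> into \<open>m\<close> classes.
\<close>

definition labellings :: "'j set \<Rightarrow> nat \<Rightarrow> ('j \<Rightarrow> nat) set" where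
  "labellings J m = {\<sigma> \<in> J \<rightarrow>\<^sub>E {..<m}. \<sigma> ` J = {..<m}}"

lemma finite_labellings: "finite J \<Longrightarrow> finite (labellings J m)"
  unfolding labellings_def by (intro finite_subset[OF _ finite_PiE[of J "\<lambda>_. {..<m}"]]) auto

text \<open>
  Once the injective choice \<open>g\<close> of a point for each label is fixed, a labelling carries the same
  information as a map whose values are exactly the chosen points.
\<close>

lemma sum_labellings_compose:
  fixes F :: "('j \<Rightarrow> 'a) \<Rightarrow> real"
  assumes g: "g \<in> {..<m} \<rightarrow>\<^sub>E T" "inj_on g {..<m}"
  shows "(\<Sum>\<sigma>\<in>labellings J m. F (\<lambda>p\<in>J. g (\<sigma> p))) = (\<Sum>f\<in>{f \<in> J \<rightarrow>\<^sub>E T. f ` J = g ` {..<m}}. F f)"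
proof (rule sum.reindex_bij_witness[where j = "\<lambda>\<sigma>. \<lambda>p\<in>J. g (\<sigma> p)"
      and i = "\<lambda>f. \<lambda>p\<in>J. inv_into {..<m} g (f p)"], goal_cases)
  case (1 \<sigma>)
  then show ?case
    using g by (auto simp: labellings_def fun_eq_iff PiE_iff extensional_def)
next
  case (2 \<sigma>)
  then have "\<sigma> \<in> J \<rightarrow>\<^sub>E {..<m}" and im: "\<sigma> ` J = {..<m}"
    by (auto simp: labellings_def)
  moreover have "(\<lambda>p\<in>J. g (\<sigma> p)) ` J = g ` {..<m}"
    unfolding im[symmetric] by auto
  ultimately show ?case
    using g by (auto simp: PiE_iff)
next
  case (3 f)
  then have im: "f ` J = g ` {..<m}" by auto
  then have "g (inv_into {..<m} g (f p)) = f p" if "p \<in> J" for p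
    using that by (intro f_inv_into_f) auto
  then show ?case
    using 3 by (auto simp: fun_eq_iff PiE_iff extensional_def)
next
  case (4 f)
  then have im: "f ` J = g ` {..<m}" by auto
  have "(\<lambda>p\<in>J. inv_into {..<m} g (f p)) ` J = inv_into {..<m} g ` f ` J"
    by (auto simp: image_image)
  also have "\<dots> = {..<m}"
    unfolding im using g by (auto simp: image_image)
  finally show ?case
    using im by (auto simp: labellings_def PiE_iff)
next
  case (5 f)
  then show ?case by auto
qed

text \<open>
  A map \<open>f\<close> factors as an injective \<open>g\<close> after a labelling only if \<open>m\<close> is the number of its values.
  Then \<open>g\<close> can be any enumeration of these values and determines the labelling, so that there are
  \<open>m!\<close> factorizations. The division by \<open>m!\<close> compensates for this and avoids a choice of
  canonical labellings.
\<close>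

lemma sum_PiE_by_labellings:
  fixes F :: "('j \<Rightarrow> 'a) \<Rightarrow> real"
  assumes J: "finite J" and T: "finite T"
  shows "(\<Sum>f\<in>J \<rightarrow>\<^sub>E T. F f) =
    (\<Sum>m\<le>card J. \<Sum>\<sigma>\<in>labellings J m.
       \<Sum>g\<in>{g \<in> {..<m} \<rightarrow>\<^sub>E T. inj_on g {..<m}}. F (\<lambda>p\<in>J. g (\<sigma> p)) / fact m)"
proof -
  define G where "G m = {g \<in> {..<m} \<rightarrow>\<^sub>E T. inj_on g {..<m}}" for m :: nat
  have finG: "finite (G m)" for m
    unfolding G_def using T by (intro finite_subset[OF _ finite_PiE[of "{..<m}" "\<lambda>_. T"]]) auto
  have finP: "finite (J \<rightarrow>\<^sub>E T)"
    using J T by (intro finite_PiE) auto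
  have count: "(\<Sum>m\<le>card J. \<Sum>g\<in>{g \<in> G m. f ` J = g ` {..<m}}. 1 / fact m) = (1::real)"
    if f: "f \<in> J \<rightarrow>\<^sub>E T" for f
  proof -
    let ?A = "f ` J"
    have A: "finite ?A" "?A \<subseteq> T" "card ?A \<le> card J"
      using f J card_image_le by auto
    have "(\<Sum>m\<le>card J. \<Sum>g\<in>{g \<in> G m. ?A = g ` {..<m}}. 1 / fact m :: real) =
        (\<Sum>m\<le>card J. if m = card ?A then 1 else 0)"
    proof (rule sum.cong[OF refl])
      fix m
      show "(\<Sum>g\<in>{g \<in> G m. ?A = g ` {..<m}}. 1 / fact m :: real) = (if m = card ?A then 1 else 0)"
      proof (cases "m = card ?A")
        case True
        have "{g \<in> G m. ?A = g ` {..<m}} =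
            {g \<in> {..<m} \<rightarrow>\<^sub>E ?A. inj_on g {..<m} \<and> g ` {..<m} = ?A}"
          using A(2) by (auto simp: G_def PiE_iff)
        then have "card {g \<in> G m. ?A = g ` {..<m}} = fact m"
          using card_bijections_PiE[OF A(1) True[symmetric]] by metis
        then show ?thesis using True by simp
      next
        case False
        then have "{g \<in> G m. ?A = g ` {..<m}} = {}"
          by (auto simp: G_def card_image)
        then show ?thesis using False by (simp only:) simp
      qed
    qed
    also have "\<dots> = 1"
      using A(3) by (simp add: sum.delta')
    finally show ?thesis .
  qed
  have "(\<Sum>m\<le>card J. \<Sum>\<sigma>\<in>labellings J m. \<Sum>g\<in>G m. F (\<lambda>p\<in>J. g (\<sigma> p)) / fact m) =
      (\<Sum>m\<le>card J. \<Sum>g\<in>G m. (\<Sum>\<sigma>\<in>labellings J m. F (\<lambda>p\<in>J. g (\<sigma> p))) / fact m)"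
    by (intro sum.cong refl, subst sum.swap) (simp add: sum_divide_distrib)
  also have "\<dots> = (\<Sum>m\<le>card J. \<Sum>g\<in>G m. (\<Sum>f\<in>{f \<in> J \<rightarrow>\<^sub>E T. f ` J = g ` {..<m}}. F f) / fact m)"
    by (intro sum.cong refl arg_cong2[where f = "(/)"] sum_labellings_compose[where T = T])
       (auto simp: G_def)
  also have "\<dots> = (\<Sum>m\<le>card J. \<Sum>g\<in>G m. \<Sum>f\<in>J \<rightarrow>\<^sub>E T. if f ` J = g ` {..<m} then F f / fact m else 0)"
    by (intro sum.cong refl) (simp add: sum.inter_filter[OF finP, symmetric] sum_divide_distrib)
  also have "\<dots> = (\<Sum>f\<in>J \<rightarrow>\<^sub>E T. \<Sum>m\<le>card J. \<Sum>g\<in>G m. if f ` J = g ` {..<m} then F f / fact m else 0)"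
    by (subst sum.swap[where B = "J \<rightarrow>\<^sub>E T"], subst sum.swap[where B = "J \<rightarrow>\<^sub>E T" and A = "{..card J}"]) simp
  also have "\<dots> = (\<Sum>f\<in>J \<rightarrow>\<^sub>E T. F f * (\<Sum>m\<le>card J. \<Sum>g\<in>{g \<in> G m. f ` J = g ` {..<m}}. 1 / fact m))"
    by (intro sum.cong refl) (simp add: sum.inter_filter[OF finG, symmetric] sum_distrib_left mult.commute)
  also have "\<dots> = (\<Sum>f\<in>J \<rightarrow>\<^sub>E T. F f)"
    using count by simp
  finally show ?thesis by (simp add: G_def)
qed

section \<open>Supports of test functions\<close>

text \<open>
  Compactness of the support in the product amounts to one compact set that contains all
  coordinates: the projections of a compact set are compact, and conversely a power of a compact
  set is compact and, in a Hausdorff space, closed.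
\<close>

lemma test_function_iff:
  fixes \<psi> :: "(nat \<Rightarrow> 'a::{second_countable_topology, t2_space}) \<Rightarrow> real"
  shows "test_function r \<psi> \<longleftrightarrow>
    \<psi> \<in> borel_measurable (Pi\<^sub>M {..<r} (\<lambda>_. borel)) \<and>
    (\<exists>B. \<forall>x\<in>{..<r} \<rightarrow>\<^sub>E UNIV. \<bar>\<psi> x\<bar> \<le> B) \<and>
    (\<exists>C. compact C \<and> (\<forall>x\<in>{..<r} \<rightarrow>\<^sub>E UNIV. \<psi> x \<noteq> 0 \<longrightarrow> x ` {..<r} \<subseteq> C))"
proof -
  let ?T = "tuple_topology r :: (nat \<Rightarrow> 'a) topology"
  let ?U = "{x \<in> {..<r} \<rightarrow>\<^sub>E UNIV. \<psi> x \<noteq> 0}"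
  have top: "topspace ?T = {..<r} \<rightarrow>\<^sub>E UNIV"
    by simp
  have "bounded (\<psi> ` ({..<r} \<rightarrow>\<^sub>E UNIV)) \<longleftrightarrow> (\<exists>B. \<forall>x\<in>{..<r} \<rightarrow>\<^sub>E UNIV. \<bar>\<psi> x\<bar> \<le> B)"
    by (simp add: bounded_iff)
  moreover have "compactin ?T (?T closure_of ?U) \<longleftrightarrow>
      (\<exists>C. compact C \<and> (\<forall>x\<in>{..<r} \<rightarrow>\<^sub>E UNIV. \<psi> x \<noteq> 0 \<longrightarrow> x ` {..<r} \<subseteq> C))" (is "?l \<longleftrightarrow> ?r")
  proof
    assume l: ?l
    define C where "C = (\<Union>i<r. (\<lambda>x. x i) ` (?T closure_of ?U))"
    have "compact ((\<lambda>x. x i) ` (?T closure_of ?U))" if "i < r" for i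
    proof -
      have "compactin euclidean ((\<lambda>x. x i) ` (?T closure_of ?U))"
        using l by (rule image_compactin) (use that in \<open>auto intro: continuous_map_product_projection\<close>)
      then show ?thesis by simp
    qed
    then have "compact C"
      unfolding C_def by (intro compact_UN) auto
    moreover have "?U \<subseteq> ?T closure_of ?U"
      by (rule closure_of_subset) auto
    ultimately show ?r
      unfolding C_def by (intro exI[of _ C]) (auto simp: C_def)
  next
    assume ?r
    then obtain C where C: "compact C" "\<And>x. x \<in> ?U \<Longrightarrow> x ` {..<r} \<subseteq> C"
      by auto
    let ?K = "{..<r} \<rightarrow>\<^sub>E C"
    have K: "compactin ?T ?K"
      using C by (simp add: compactin_PiE)
    have "Hausdorff_space (euclidean :: 'a topology)"
      unfolding Hausdorff_space_def disjnt_def by simp (metis hausdorff)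
    then have "Hausdorff_space ?T"
      by (simp add: Hausdorff_space_product_topology)
    then have "closedin ?T ?K"
      using K compactin_imp_closedin by blast
    moreover have "?U \<subseteq> ?K"
      using C(2) by (force simp: PiE_iff)
    ultimately have "?T closure_of ?U \<subseteq> ?K"
      by (intro closure_of_minimal)
    then show ?l
      by (rule closed_compactin[OF K _ closedin_closure_of])
  qed
  ultimately show ?thesis
    unfolding test_function_def by simp
qed

lemma test_functionE:
  fixes \<psi> :: "(nat \<Rightarrow> 'a::{second_countable_topology, t2_space}) \<Rightarrow> real"
  assumes "test_function r \<psi>"
  obtains B C where "\<psi> \<in> borel_measurable (Pi\<^sub>M {..<r} (\<lambda>_. borel))"
    and "\<And>x. x \<in> {..<r} \<rightarrow>\<^sub>E UNIV \<Longrightarrow> \<bar>\<psi> x\<bar> \<le> B"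
    and "compact C" "\<And>x. x \<in> {..<r} \<rightarrow>\<^sub>E UNIV \<Longrightarrow> \<psi> x \<noteq> 0 \<Longrightarrow> x ` {..<r} \<subseteq> C"
proof -
  note \<psi> = assms[unfolded test_function_iff]
  from \<psi> obtain B where "\<forall>x\<in>{..<r} \<rightarrow>\<^sub>E UNIV. \<bar>\<psi> x\<bar> \<le> B" by auto
  moreover from \<psi> obtain C where
    "compact C" "\<forall>x\<in>{..<r} \<rightarrow>\<^sub>E UNIV. \<psi> x \<noteq> 0 \<longrightarrow> x ` {..<r} \<subseteq> C" by auto
  ultimately show thesis
    using \<psi> by (intro that[of B C]) simp_all
qed

section \<open>Powers of linear statistics\<close>

definition injective_tuples :: "nat \<Rightarrow> 'a set \<Rightarrow> (nat \<Rightarrow> 'a) set" where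
  "injective_tuples r S = {x \<in> {..<r} \<rightarrow>\<^sub>E S. inj_on x {..<r}}"

lemma finite_injective_tuples: "finite T \<Longrightarrow> finite (injective_tuples r T)"
  unfolding injective_tuples_def by (intro finite_subset[OF _ finite_PiE[of "{..<r}" "\<lambda>_. T"]]) auto

text \<open>
  Tuples that leave \<open>C\<close> contribute nothing, so the infinite sum reduces to a finite one.
\<close>

lemma linear_statistic_eq_sum:
  assumes C: "\<And>x. x \<in> {..<r} \<rightarrow>\<^sub>E UNIV \<Longrightarrow> \<psi> x \<noteq> 0 \<Longrightarrow> x ` {..<r} \<subseteq> C"
    and fin: "finite (S \<inter> C)"
  shows "linear_statistic r \<psi> S = (\<Sum>x\<in>injective_tuples r (S \<inter> C). \<psi> x)"
proof -
  have "x \<in> injective_tuples r (S \<inter> C)"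
    if "x \<in> injective_tuples r S" "\<psi> x \<noteq> 0" for x
    using that C[of x] by (force simp: injective_tuples_def PiE_iff)
  moreover have "injective_tuples r (S \<inter> C) \<subseteq> injective_tuples r S"
    by (auto simp: injective_tuples_def)
  ultimately have "linear_statistic r \<psi> S = (\<Sum>\<^sub>\<infinity>x\<in>injective_tuples r (S \<inter> C). \<psi> x)"
    unfolding linear_statistic_def injective_tuples_def[symmetric]
    by (intro infsum_cong_neutral) auto
  then show ?thesis
    using finite_injective_tuples[OF fin] by simp
qed

text \<open>
  The position \<open>(l, i)\<close> is the \<open>i\<close>-th entry of the \<open>l\<close>-th factor of \<open>\<Lambda>\<^sup>j\<close>. Labels are distinct within a
  factor because each factor sums over tuples of distinct points.
\<close>

definition overlap_patterns :: "nat \<Rightarrow> nat \<Rightarrow> (nat \<times> (nat \<times> nat \<Rightarrow> nat)) set" where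
  "overlap_patterns r j =
     (SIGMA m:{..card ({..<j} \<times> {..<r})}.
        {\<sigma> \<in> labellings ({..<j} \<times> {..<r}) m. \<forall>l<j. inj_on (\<lambda>i. \<sigma> (l, i)) {..<r}})"

definition overlap_function ::
    "((nat \<Rightarrow> 'a) \<Rightarrow> real) \<Rightarrow> nat \<Rightarrow> nat \<Rightarrow> nat \<times> (nat \<times> nat \<Rightarrow> nat) \<Rightarrow> (nat \<Rightarrow> 'a) \<Rightarrow> real" where
  "overlap_function \<phi> r j p = (\<lambda>g. (\<Prod>l<j. \<phi> (\<lambda>i\<in>{..<r}. g (snd p (l, i)))) / fact (fst p))"

lemma finite_overlap_patterns: "finite (overlap_patterns r j)"
  unfolding overlap_patterns_def
  by (intro finite_SigmaI) (auto intro: finite_subset[OF _ finite_labellings])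

lemma overlap_patterns_arity:
  assumes "p \<in> overlap_patterns r j" "1 \<le> r" "1 \<le> j"
  shows "1 \<le> fst p"
proof -
  have "snd p ` ({..<j} \<times> {..<r}) = {..<fst p}" "(0, 0) \<in> {..<j} \<times> {..<r}"
    using assms by (auto simp: overlap_patterns_def labellings_def)
  then show ?thesis by (cases "fst p") auto
qed

text \<open>
  For a single factor, the position itself can be taken as its label.
\<close>

lemma overlap_patterns_nonempty: "overlap_patterns r 1 \<noteq> {}"
proof -
  have "(\<lambda>p\<in>{..<1::nat} \<times> {..<r}. snd p) \<in> labellings ({..<1::nat} \<times> {..<r}) r"
    by (auto simp: labellings_def image_iff lessThan_Suc)
  then have "(r, \<lambda>p\<in>{..<1} \<times> {..<r}. snd p) \<in> overlap_patterns r 1"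
    by (auto simp: overlap_patterns_def inj_on_def)
  then show ?thesis by blast
qed

text \<open>
  The power is a sum over \<open>j\<close>-tuples of injective \<open>r\<close>-tuples, which after uncurrying becomes a sum over
  all maps from positions to \<open>T\<close>, where the maps that are not injective on some block get
  weight zero. This sum is regrouped by labellings. Since \<open>g\<close> is injective, the weight depends
  only on the labelling, and what remains are the overlap patterns.
\<close>

lemma power_sum_injective_tuples:
  assumes T: "finite T"
  shows "(\<Sum>x\<in>injective_tuples r T. \<phi> x) ^ j =
    (\<Sum>p\<in>overlap_patterns r j. \<Sum>g\<in>injective_tuples (fst p) T. overlap_function \<phi> r j p g)"
proof -
  define J where "J = {..<j} \<times> {..<r}"
  have J: "finite J" by (simp add: J_def)
  define F where "F f = (if \<forall>l<j. inj_on (\<lambda>i. f (l, i)) {..<r}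
      then \<Prod>l<j. \<phi> (\<lambda>i\<in>{..<r}. f (l, i)) else 0)" for f :: "nat \<times> nat \<Rightarrow> 'a"
  have "(\<Sum>x\<in>injective_tuples r T. \<phi> x) ^ j = (\<Prod>l<j. \<Sum>x\<in>injective_tuples r T. \<phi> x)"
    by simp
  also have "\<dots> = (\<Sum>X\<in>{..<j} \<rightarrow>\<^sub>E injective_tuples r T. \<Prod>l<j. \<phi> (X l))"
    by (intro prod_sum_PiE finite_injective_tuples T) simp
  also have "\<dots> = (\<Sum>f\<in>{f \<in> J \<rightarrow>\<^sub>E T. \<forall>l<j. inj_on (\<lambda>i. f (l, i)) {..<r}}.
      \<Prod>l<j. \<phi> (\<lambda>i\<in>{..<r}. f (l, i)))"
  proof (rule sum.reindex_bij_witness[where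
        i = "\<lambda>f. \<lambda>l\<in>{..<j}. \<lambda>i\<in>{..<r}. f (l, i)" and j = "\<lambda>X. \<lambda>(l, i)\<in>J. X l i"], goal_cases)
    case (1 X)
    show ?case
    proof
      fix l show "(\<lambda>l\<in>{..<j}. \<lambda>i\<in>{..<r}. (\<lambda>(l, i)\<in>J. X l i) (l, i)) l = X l"
        using 1 by (auto simp: J_def injective_tuples_def PiE_iff fun_eq_iff extensional_def)
    qed
  next
    case (2 X)
    then have "inj_on (X l) {..<r}" "X l \<in> {..<r} \<rightarrow>\<^sub>E T" if "l < j" for l
      using that by (auto simp: injective_tuples_def PiE_iff)
    then show ?case
      by (fastforce simp: J_def inj_on_def PiE_iff)
  next
    case (3 f)
    then show ?case
      by (auto simp: J_def fun_eq_iff PiE_iff extensional_def)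
  next
    case (4 f)
    then show ?case
      by (auto simp: J_def injective_tuples_def PiE_iff inj_on_def)
  next
    case (5 X)
    have "(\<lambda>i\<in>{..<r}. (\<lambda>(l, i)\<in>J. X l i) (l, i)) = X l" if "l < j" for l
      using 5 that by (auto simp: J_def injective_tuples_def PiE_iff fun_eq_iff extensional_def)
    then show ?case
      by simp
  qed
  also have "\<dots> = (\<Sum>f\<in>J \<rightarrow>\<^sub>E T. F f)"
    unfolding F_def using J T by (intro sum.inter_filter finite_PiE)
  also have "\<dots> = (\<Sum>m\<le>card J. \<Sum>\<sigma>\<in>labellings J m.
      \<Sum>g\<in>injective_tuples m T. F (\<lambda>p\<in>J. g (\<sigma> p)) / fact m)"
    using sum_PiE_by_labellings[OF J T, of F] by (simp add: injective_tuples_def)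
  also have "\<dots> = (\<Sum>m\<le>card J. \<Sum>\<sigma>\<in>labellings J m.
      if \<forall>l<j. inj_on (\<lambda>i. \<sigma> (l, i)) {..<r}
      then \<Sum>g\<in>injective_tuples m T. overlap_function \<phi> r j (m, \<sigma>) g else 0)"
  proof (intro sum.cong refl)
    fix m \<sigma> assume \<sigma>: "\<sigma> \<in> labellings J m"
    have "F (\<lambda>p\<in>J. g (\<sigma> p)) / fact m =
        (if \<forall>l<j. inj_on (\<lambda>i. \<sigma> (l, i)) {..<r} then overlap_function \<phi> r j (m, \<sigma>) g else 0)"
      if g: "g \<in> injective_tuples m T" for g
    proof -
      have lab: "\<sigma> (l, i) < m" if "l < j" "i < r" for l i
        using \<sigma> that by (auto simp: labellings_def J_def PiE_iff)
      have "inj_on (\<lambda>i. (\<lambda>p\<in>J. g (\<sigma> p)) (l, i)) {..<r} \<longleftrightarrow> inj_on (\<lambda>i. \<sigma> (l, i)) {..<r}"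
        if "l < j" for l
        using g lab that by (auto simp: inj_on_def J_def injective_tuples_def)
      moreover have "(\<lambda>i\<in>{..<r}. (\<lambda>p\<in>J. g (\<sigma> p)) (l, i)) = (\<lambda>i\<in>{..<r}. g (\<sigma> (l, i)))"
        if "l < j" for l
        using that by (auto simp: J_def)
      ultimately show ?thesis
        by (auto simp: F_def overlap_function_def)
    qed
    then have "(\<Sum>g\<in>injective_tuples m T. F (\<lambda>p\<in>J. g (\<sigma> p)) / fact m) =
        (\<Sum>g\<in>injective_tuples m T. if \<forall>l<j. inj_on (\<lambda>i. \<sigma> (l, i)) {..<r}
         then overlap_function \<phi> r j (m, \<sigma>) g else 0)"
      by (intro sum.cong refl)
    also have "\<dots> = (if \<forall>l<j. inj_on (\<lambda>i. \<sigma> (l, i)) {..<r}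
         then \<Sum>g\<in>injective_tuples m T. overlap_function \<phi> r j (m, \<sigma>) g else 0)"
      by (rule if_split[THEN iffD2]) (auto intro!: sum.neutral)
    finally show "(\<Sum>g\<in>injective_tuples m T. F (\<lambda>p\<in>J. g (\<sigma> p)) / fact m) = \<dots>" .
  qed
  also have "\<dots> = (\<Sum>(m, \<sigma>)\<in>overlap_patterns r j.
      \<Sum>g\<in>injective_tuples m T. overlap_function \<phi> r j (m, \<sigma>) g)"
    unfolding overlap_patterns_def J_def[symmetric]
    using J by (subst sum.Sigma[symmetric])
      (auto simp: finite_labellings sum.inter_filter)
  finally show ?thesis by (simp add: case_prod_beta)
qed

text \<open>
  If the product does not vanish then no factor does, and since the labelling is surjective,
  every coordinate of \<open>g\<close> occurs as an argument of some factor.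
\<close>

lemma overlap_function_support:
  assumes C: "\<And>x. x \<in> {..<r} \<rightarrow>\<^sub>E UNIV \<Longrightarrow> \<phi> x \<noteq> 0 \<Longrightarrow> x ` {..<r} \<subseteq> C"
    and p: "p \<in> overlap_patterns r j" and g: "overlap_function \<phi> r j p g \<noteq> 0"
  shows "g ` {..<fst p} \<subseteq> C"
proof -
  obtain m \<sigma> where p_eq: "p = (m, \<sigma>)" by (cases p)
  have surj: "\<sigma> ` ({..<j} \<times> {..<r}) = {..<m}"
    using p by (auto simp: p_eq overlap_patterns_def labellings_def)
  have "\<phi> (\<lambda>i\<in>{..<r}. g (\<sigma> (l, i))) \<noteq> 0" if "l < j" for l
    using g that by (auto simp: overlap_function_def p_eq)
  then have "(\<lambda>i\<in>{..<r}. g (\<sigma> (l, i))) ` {..<r} \<subseteq> C" if "l < j" for l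
    using that by (intro C) auto
  then show ?thesis
    unfolding p_eq fst_conv surj[symmetric] by auto
qed

lemma test_function_overlap_function:
  fixes \<phi> :: "(nat \<Rightarrow> 'a::{second_countable_topology, t2_space}) \<Rightarrow> real"
  assumes \<phi>: "test_function r \<phi>" and p: "p \<in> overlap_patterns r j"
  shows "test_function (fst p) (overlap_function \<phi> r j p)"
proof -
  obtain m \<sigma> where p_eq: "p = (m, \<sigma>)" by (cases p)
  have surj: "\<sigma> ` ({..<j} \<times> {..<r}) = {..<m}"
    using p by (auto simp: p_eq overlap_patterns_def labellings_def)
  then have lab: "\<sigma> (l, i) < m" if "l < j" "i < r" for l i
    using that by blast
  obtain B C where meas: "\<phi> \<in> borel_measurable (Pi\<^sub>M {..<r} (\<lambda>_. borel))"
    and B: "\<And>x. x \<in> {..<r} \<rightarrow>\<^sub>E UNIV \<Longrightarrow> \<bar>\<phi> x\<bar> \<le> B"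
    and C: "compact C" "\<And>x. x \<in> {..<r} \<rightarrow>\<^sub>E UNIV \<Longrightarrow> \<phi> x \<noteq> 0 \<Longrightarrow> x ` {..<r} \<subseteq> C"
    using \<phi> by (rule test_functionE) (rule that)
  have "(\<lambda>g. \<lambda>i\<in>{..<r}. g (\<sigma> (l, i))) \<in> Pi\<^sub>M {..<m} (\<lambda>_. borel :: 'a measure) \<rightarrow>\<^sub>M Pi\<^sub>M {..<r} (\<lambda>_. borel)"
    if "l < j" for l
    by (rule measurable_restrict, rule measurable_component_singleton) (use that lab in auto)
  then have "overlap_function \<phi> r j p \<in> borel_measurable (Pi\<^sub>M {..<m} (\<lambda>_. borel))"
    unfolding overlap_function_def p_eq fst_conv snd_conv
    by (intro borel_measurable_divide borel_measurable_prod borel_measurable_const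
        measurable_compose[OF _ meas]) auto
  moreover have "\<bar>overlap_function \<phi> r j p g\<bar> \<le> B ^ j" for g
  proof -
    have "\<bar>overlap_function \<phi> r j p g\<bar> = \<bar>\<Prod>l<j. \<phi> (\<lambda>i\<in>{..<r}. g (\<sigma> (l, i)))\<bar> / fact m"
      by (simp add: overlap_function_def p_eq)
    also have "\<dots> \<le> \<bar>\<Prod>l<j. \<phi> (\<lambda>i\<in>{..<r}. g (\<sigma> (l, i)))\<bar> / 1"
      by (intro divide_left_mono fact_ge_1) auto
    also have "\<dots> = (\<Prod>l<j. \<bar>\<phi> (\<lambda>i\<in>{..<r}. g (\<sigma> (l, i)))\<bar>)"
      by (simp add: abs_prod)
    also have "\<dots> \<le> (\<Prod>l<j. B)"
      by (intro prod_mono) (auto intro!: B split: if_splits)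
    finally show ?thesis by simp
  qed
  moreover have "g ` {..<m} \<subseteq> C" if "overlap_function \<phi> r j p g \<noteq> 0" for g
    using overlap_function_support[OF C(2) p that] by (simp add: p_eq)
  ultimately show ?thesis
    unfolding test_function_iff p_eq fst_conv
    by (intro conjI exI[of _ "B ^ j"] exI[of _ C] ballI impI C(1))
qed

text \<open>
  All the test functions involved have their support in a power of the same compact set \<open>C\<close>, so
  the identity is that of finite sums over \<open>S \<inter> C\<close>.
\<close>

lemma linear_statistic_power:
  fixes \<phi> :: "(nat \<Rightarrow> 'a::{second_countable_topology, t2_space}) \<Rightarrow> real"
  assumes \<phi>: "test_function r \<phi>" and S: "S \<in> locally_finite_subsets A"
  shows "linear_statistic r \<phi> S ^ j =
    (\<Sum>p\<in>overlap_patterns r j. linear_statistic (fst p) (overlap_function \<phi> r j p) S)"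
proof -
  obtain B C where "\<phi> \<in> borel_measurable (Pi\<^sub>M {..<r} (\<lambda>_. borel))"
    and "\<And>x. x \<in> {..<r} \<rightarrow>\<^sub>E UNIV \<Longrightarrow> \<bar>\<phi> x\<bar> \<le> B"
    and C: "compact C" "\<And>x. x \<in> {..<r} \<rightarrow>\<^sub>E UNIV \<Longrightarrow> \<phi> x \<noteq> 0 \<Longrightarrow> x ` {..<r} \<subseteq> C"
    using \<phi> by (rule test_functionE) (rule that)
  have fin: "finite (S \<inter> C)"
    using S C(1) by (auto simp: locally_finite_subsets_def)
  have "linear_statistic (fst p) (overlap_function \<phi> r j p) S =
      (\<Sum>g\<in>injective_tuples (fst p) (S \<inter> C). overlap_function \<phi> r j p g)"
    if "p \<in> overlap_patterns r j" for p
    using linear_statistic_eq_sum[OF overlap_function_support[OF C(2) that] fin] .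
  moreover have "linear_statistic r \<phi> S = (\<Sum>x\<in>injective_tuples r (S \<inter> C). \<phi> x)"
    by (rule linear_statistic_eq_sum[OF C(2) fin])
  ultimately show ?thesis
    using power_sum_injective_tuples[OF fin, of \<phi> r j] by simp
qed

section \<open>Central moments as functions of raw moments\<close>

text \<open>
  The Lipschitz estimate for the monomials of the binomial expansion of a central moment.
\<close>

lemma power_mult_diff_le:
  fixes x y z w B \<eta> :: real
  assumes "\<bar>x\<bar> \<le> B" "\<bar>y\<bar> \<le> B" "\<bar>w\<bar> \<le> B" "\<bar>x - y\<bar> \<le> \<eta>" "\<bar>z - w\<bar> \<le> \<eta>"
  shows "\<bar>x ^ a * z - y ^ a * w\<bar> \<le> real (Suc a) * B ^ a * \<eta>"
proof (induction a)
  case 0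
  then show ?case using assms by simp
next
  case (Suc a)
  have B: "0 \<le> B" using assms by linarith
  have "x ^ Suc a * z - y ^ Suc a * w = x * (x ^ a * z - y ^ a * w) + (x - y) * (y ^ a * w)"
    by (simp add: algebra_simps)
  also have "\<bar>\<dots>\<bar> \<le> \<bar>x\<bar> * \<bar>x ^ a * z - y ^ a * w\<bar> + \<bar>x - y\<bar> * (\<bar>y\<bar> ^ a * \<bar>w\<bar>)"
    by (intro order_trans[OF abs_triangle_ineq]) (simp add: abs_mult power_abs)
  also have "\<dots> \<le> B * (real (Suc a) * B ^ a * \<eta>) + \<eta> * (B ^ a * B)"
    using assms B Suc by (intro add_mono mult_mono power_mono mult_nonneg_nonneg) auto
  also have "\<dots> = real (Suc (Suc a)) * B ^ Suc a * \<eta>"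
    by (simp add: algebra_simps)
  finally show ?case .
qed

lemma abs_power_le_one_plus_even_power:
  fixes x :: real
  shows "\<bar>x\<bar> ^ k \<le> 1 + x ^ (2 * k)"
proof -
  have "0 \<le> (\<bar>x\<bar> ^ k - 1/2)\<^sup>2" by simp
  then have "\<bar>x\<bar> ^ k \<le> 1 + (\<bar>x\<bar> ^ k)\<^sup>2"
    by (simp add: power2_eq_square algebra_simps)
  also have "(\<bar>x\<bar> ^ k)\<^sup>2 = x ^ (2 * k)"
    by (metis power_even_abs power_mult mult.commute even_mult_iff even_numeral)
  finally show ?thesis .
qed

text \<open>
  A consequence of \<open>(x - y)\<^sup>2 \<le> 4 max (x\<^sup>2) (y\<^sup>2)\<close>.
\<close>

lemma even_power_diff_le:
  fixes x y :: real
  shows "(x - y) ^ (2 * k) \<le> 4 ^ k * (x ^ (2 * k) + y ^ (2 * k))"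
proof -
  have "(x - y)\<^sup>2 \<le> 4 * max (x\<^sup>2) (y\<^sup>2)"
  proof -
    have "(x - y)\<^sup>2 + (x + y)\<^sup>2 = 2 * x\<^sup>2 + 2 * y\<^sup>2"
      by (simp add: power2_eq_square algebra_simps)
    then show ?thesis
      using zero_le_power2[of "x + y"] by linarith
  qed
  then have "((x - y)\<^sup>2) ^ k \<le> (4 * max (x\<^sup>2) (y\<^sup>2)) ^ k"
    by (intro power_mono) auto
  also have "\<dots> = 4 ^ k * max (x\<^sup>2) (y\<^sup>2) ^ k"
    by (simp add: power_mult_distrib)
  also have "\<dots> \<le> 4 ^ k * ((x\<^sup>2) ^ k + (y\<^sup>2) ^ k)"
    by (intro mult_left_mono) (auto simp: max_def)
  finally show ?thesis
    by (simp add: power_mult)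
qed

context prob_space
begin

lemma central_moment_binomial:
  fixes f :: "'a \<Rightarrow> real"
  assumes int: "\<And>j. j \<le> k \<Longrightarrow> integrable M (\<lambda>x. f x ^ j)"
  shows "expectation (\<lambda>x. (f x - c) ^ k) =
    (\<Sum>j\<le>k. real (k choose j) * ((- c) ^ (k - j) * expectation (\<lambda>x. f x ^ j)))"
proof -
  have "(f x - c) ^ k = (\<Sum>j\<le>k. (real (k choose j) * (- c) ^ (k - j)) * f x ^ j)" for x
    using binomial_ring[of "f x" "- c" k] by (simp add: mult_ac)
  then have "expectation (\<lambda>x. (f x - c) ^ k) =
      (\<Sum>j\<le>k. expectation (\<lambda>x. (real (k choose j) * (- c) ^ (k - j)) * f x ^ j))"
    using int by (simp add: Bochner_Integration.integral_sum)
  then show ?thesis by (simp add: mult_ac)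
qed

text \<open>
  The absolute power of order \<open>k\<close> is first replaced by the even power \<open>2k\<close>, whose integral needs no
  absolute values; Jensen's inequality then absorbs the power of the mean into that
  raw moment. The point is that the bound is linear in a raw moment.
\<close>

lemma abs_central_moment_le:
  fixes f :: "'a \<Rightarrow> real"
  assumes k: "1 \<le> k" and int: "\<And>j. j \<le> 2 * k \<Longrightarrow> integrable M (\<lambda>x. f x ^ j)"
  shows "\<bar>expectation (\<lambda>x. (f x - expectation f) ^ k)\<bar> \<le>
    1 + 2 * 4 ^ k * expectation (\<lambda>x. f x ^ (2 * k))"
proof -
  let ?c = "expectation f"
  have f: "integrable M f"
    using int[of 1] k by simp
  have [measurable]: "f \<in> borel_measurable M"
    using f by simp
  have even: "integrable M (\<lambda>x. f x ^ (2 * k))"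
    using int by simp
  have le: "\<bar>f x - ?c\<bar> ^ k \<le> 1 + 4 ^ k * (f x ^ (2 * k) + ?c ^ (2 * k))" for x
    using abs_power_le_one_plus_even_power[of "f x - ?c" k] even_power_diff_le[of "f x" ?c k]
    by linarith
  have int_abs: "integrable M (\<lambda>x. \<bar>f x - ?c\<bar> ^ k)"
  proof (rule Bochner_Integration.integrable_bound)
    show "integrable M (\<lambda>x. 1 + 4 ^ k * (f x ^ (2 * k) + ?c ^ (2 * k)))"
      using even by simp
    show "AE x in M. norm (\<bar>f x - ?c\<bar> ^ k) \<le> norm (1 + 4 ^ k * (f x ^ (2 * k) + ?c ^ (2 * k)))"
      using le by (intro AE_I2) (auto intro!: order_trans[OF le])
  qed simp
  have "\<bar>expectation (\<lambda>x. (f x - ?c) ^ k)\<bar> \<le> expectation (\<lambda>x. \<bar>f x - ?c\<bar> ^ k)"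
    using integral_abs_bound[of M "\<lambda>x. (f x - ?c) ^ k"] by (simp add: power_abs)
  also have "\<dots> \<le> expectation (\<lambda>x. 1 + 4 ^ k * (f x ^ (2 * k) + ?c ^ (2 * k)))"
    using int_abs even le by (intro integral_mono) auto
  also have "\<dots> = 1 + 4 ^ k * (expectation (\<lambda>x. f x ^ (2 * k)) + ?c ^ (2 * k))"
    using even by (simp add: prob_space)
  also have "\<dots> \<le> 1 + 4 ^ k * (expectation (\<lambda>x. f x ^ (2 * k)) + expectation (\<lambda>x. f x ^ (2 * k)))"
    using jensens_inequality[OF f, of UNIV 0 0 "\<lambda>y. y ^ (2 * k)"] even
    by (intro add_left_mono mult_left_mono) (auto simp: convex_power_even)
  finally show ?thesis by simp
qed

end

text \<open>
  The constant of \<open>central_moment_diff_le\<close>. The sum over \<open>j\<close> is a Lipschitz constant of the central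
  moment, as a polynomial in raw moments of absolute value at most \<open>B\<close>; the other summand comes
  from the bound of \<open>abs_central_moment_le\<close> and serves for errors above one.
\<close>

definition central_moment_modulus :: "nat \<Rightarrow> real \<Rightarrow> real" where
  "central_moment_modulus k B =
     (\<Sum>j\<le>k. real (k choose j) * (real (Suc (k - j)) * B ^ (k - j))) + (2 + 2 * 4 ^ k * (2 * B + 1))"

lemma central_moment_modulus_pos: "0 \<le> B \<Longrightarrow> 0 < central_moment_modulus k B"
  unfolding central_moment_modulus_def
  by (intro add_nonneg_pos sum_nonneg add_pos_nonneg) auto

text \<open>
  For \<open>\<eta> \<le> 1\<close> the raw moments of \<open>P\<close> stay bounded by \<open>B + 1\<close> and the binomial expansion is
  Lipschitz there. For \<open>\<eta> > 1\<close> the difference is estimated by the triangle inequality: each of the two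
  central moments is bounded linearly by its raw moment of order \<open>2k\<close>, which is at most \<open>B + \<eta>\<close>,
  and this is at most a multiple of \<open>\<eta>\<close>.
\<close>

lemma central_moment_diff_le:
  assumes "prob_space P" "prob_space Q" and k: "1 \<le> k"
    and intP: "\<And>j. j \<le> 2 * k \<Longrightarrow> integrable P (\<lambda>x. linear_statistic r \<phi> x ^ j)"
    and intQ: "\<And>j. j \<le> 2 * k \<Longrightarrow> integrable Q (\<lambda>x. linear_statistic r \<phi> x ^ j)"
    and bound: "\<And>j. j \<le> 2 * k \<Longrightarrow> \<bar>raw_moment r \<phi> j Q\<bar> \<le> B"
    and \<eta>: "0 < \<eta>"
    and close: "\<And>j. 1 \<le> j \<Longrightarrow> j \<le> 2 * k \<Longrightarrow> \<bar>raw_moment r \<phi> j P - raw_moment r \<phi> j Q\<bar> \<le> \<eta>"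
  shows "\<bar>central_moment r \<phi> k P - central_moment r \<phi> k Q\<bar> \<le> central_moment_modulus k (B + 1) * \<eta>"
proof -
  interpret P: prob_space P by fact
  interpret Q: prob_space Q by fact
  have zero: "raw_moment r \<phi> 0 P = 1" "raw_moment r \<phi> 0 Q = 1"
    by (simp_all add: raw_moment_def P.prob_space Q.prob_space)
  then have B: "1 \<le> B"
    using bound[of 0] by simp
  have close': "\<bar>raw_moment r \<phi> j P - raw_moment r \<phi> j Q\<bar> \<le> \<eta>" if "j \<le> 2 * k" for j
    using close[of j] that zero \<eta> by (cases "j = 0") auto
  define S where "S = (\<Sum>j\<le>k. real (k choose j) * (real (Suc (k - j)) * (B + 1) ^ (k - j)))"
  define R where "R = 2 + 2 * 4 ^ k * (2 * (B + 1) + 1)"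
  have SR: "central_moment_modulus k (B + 1) = S + R" "0 \<le> S" "0 \<le> R"
    using B by (auto simp: central_moment_modulus_def S_def R_def intro!: sum_nonneg add_nonneg_nonneg)
  show ?thesis
  proof (cases "\<eta> \<le> 1")
    case True
    have summand: "\<bar>(- raw_moment r \<phi> 1 P) ^ (k - j) * raw_moment r \<phi> j P
        - (- raw_moment r \<phi> 1 Q) ^ (k - j) * raw_moment r \<phi> j Q\<bar>
        \<le> real (Suc (k - j)) * (B + 1) ^ (k - j) * \<eta>" if "j \<le> k" for j
      using bound[of 1] bound[of j] close'[of 1] close'[of j] that k True
      by (intro power_mult_diff_le) auto
    have "\<bar>central_moment r \<phi> k P - central_moment r \<phi> k Q\<bar> =
      \<bar>\<Sum>j\<le>k. real (k choose j) * ((- raw_moment r \<phi> 1 P) ^ (k - j) * raw_moment r \<phi> j P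
        - (- raw_moment r \<phi> 1 Q) ^ (k - j) * raw_moment r \<phi> j Q)\<bar>"
      unfolding central_moment_def
      by (subst P.central_moment_binomial, simp add: intP, subst Q.central_moment_binomial, simp add: intQ)
         (simp add: raw_moment_def sum_subtractf right_diff_distrib)
    also have "\<dots> \<le> (\<Sum>j\<le>k. real (k choose j) * (real (Suc (k - j)) * (B + 1) ^ (k - j) * \<eta>))"
      by (intro order_trans[OF sum_abs] sum_mono, unfold abs_mult)
         (intro mult_mono, use summand in auto)
    also have "\<dots> = S * \<eta>"
      by (simp add: S_def sum_distrib_right mult.assoc)
    also have "\<dots> \<le> (S + R) * \<eta>"
      using SR \<eta> by (intro mult_right_mono) auto
    finally show ?thesis using SR by simp
  next
    case False
    have "\<bar>central_moment r \<phi> k P\<bar> \<le> 1 + 2 * 4 ^ k * raw_moment r \<phi> (2 * k) P"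
      using P.abs_central_moment_le[OF k intP] by (simp add: central_moment_def raw_moment_def)
    moreover have "\<bar>central_moment r \<phi> k Q\<bar> \<le> 1 + 2 * 4 ^ k * raw_moment r \<phi> (2 * k) Q"
      using Q.abs_central_moment_le[OF k intQ] by (simp add: central_moment_def raw_moment_def)
    ultimately have "\<bar>central_moment r \<phi> k P - central_moment r \<phi> k Q\<bar> \<le>
        2 + 2 * 4 ^ k * (raw_moment r \<phi> (2 * k) P + raw_moment r \<phi> (2 * k) Q)"
      by (simp add: distrib_left)
    also have "\<dots> \<le> 2 + 2 * 4 ^ k * (2 * (B + 1) + \<eta>)"
      using bound[of "2 * k"] close'[of "2 * k"] by (intro add_left_mono mult_left_mono) auto
    also have "\<dots> \<le> 2 * \<eta> + 2 * 4 ^ k * (2 * (B + 1) * \<eta> + 1 * \<eta>)"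
      using False B by (intro add_mono mult_left_mono) auto
    also have "\<dots> = R * \<eta>"
      by (simp add: R_def algebra_simps)
    also have "\<dots> \<le> (S + R) * \<eta>"
      using SR \<eta> by (intro mult_right_mono) auto
    finally show ?thesis using SR by simp
  qed
qed

section \<open>Raw moments as sums of expectations\<close>

lemma point_process_iff:
  "point_process A P \<longleftrightarrow> prob_space P \<and> sets P = sets (configuration_space A)"
  by (auto simp: point_process_def space_prob_algebra)

lemma space_point_process:
  assumes "point_process A P"
  shows "space P = locally_finite_subsets A"
proof -
  have "space P = space (configuration_space A)"
    using assms by (intro sets_eq_imp_space_eq) (simp add: point_process_iff)
  then show ?thesis
    by (simp add: configuration_space_def space_measure_of_conv)
qed

text \<open>
  Integrability of the power is inherited from the linear statistics into which it decomposes.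
  Without it the decomposition of the raw moment would fail, as the Bochner integral is additive
  only on integrable functions.
\<close>

lemma
  fixes \<phi> :: "(nat \<Rightarrow> 'a::{second_countable_topology, t2_space}) \<Rightarrow> real"
  assumes \<phi>: "test_function r \<phi>" and P: "point_process A P"
    and int: "\<And>p. p \<in> overlap_patterns r j \<Longrightarrow>
      integrable P (linear_statistic (fst p) (overlap_function \<phi> r j p))"
  shows integrable_linear_statistic_power: "integrable P (\<lambda>S. linear_statistic r \<phi> S ^ j)"
    and raw_moment_eq_sum_mean_statistic: "raw_moment r \<phi> j P =
      (\<Sum>p\<in>overlap_patterns r j. mean_statistic (fst p) (overlap_function \<phi> r j p) P)"
proof -
  let ?f = "\<lambda>S. \<Sum>p\<in>overlap_patterns r j. linear_statistic (fst p) (overlap_function \<phi> r j p) S"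
  have eq: "linear_statistic r \<phi> S ^ j = ?f S" if "S \<in> space P" for S
    using that linear_statistic_power[OF \<phi>] by (simp add: space_point_process[OF P])
  have "integrable P ?f"
    using int by (intro Bochner_Integration.integrable_sum) auto
  moreover have "integrable P (\<lambda>S. linear_statistic r \<phi> S ^ j) \<longleftrightarrow> integrable P ?f"
    using eq by (intro Bochner_Integration.integrable_cong refl)
  ultimately show "integrable P (\<lambda>S. linear_statistic r \<phi> S ^ j)"
    by blast
  have "raw_moment r \<phi> j P = integral\<^sup>L P ?f"
    unfolding raw_moment_def using eq by (intro Bochner_Integration.integral_cong refl)
  also have "\<dots> = (\<Sum>p\<in>overlap_patterns r j. mean_statistic (fst p) (overlap_function \<phi> r j p) P)"
    unfolding mean_statistic_def using int by (intro Bochner_Integration.integral_sum) auto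
  finally show "raw_moment r \<phi> j P = \<dots>" .
qed

lemma raw_moment_diff_le:
  fixes \<phi> :: "(nat \<Rightarrow> 'a::{second_countable_topology, t2_space}) \<Rightarrow> real"
  assumes \<phi>: "test_function r \<phi>" and P: "point_process A P" and Q: "point_process A' Q"
    and intP: "\<And>p. p \<in> overlap_patterns r j \<Longrightarrow>
      integrable P (linear_statistic (fst p) (overlap_function \<phi> r j p))"
    and intQ: "\<And>p. p \<in> overlap_patterns r j \<Longrightarrow>
      integrable Q (linear_statistic (fst p) (overlap_function \<phi> r j p))"
    and close: "\<And>p. p \<in> overlap_patterns r j \<Longrightarrow>
      \<bar>mean_statistic (fst p) (overlap_function \<phi> r j p) P
       - mean_statistic (fst p) (overlap_function \<phi> r j p) Q\<bar> \<le> \<eta>"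
  shows "\<bar>raw_moment r \<phi> j P - raw_moment r \<phi> j Q\<bar> \<le> real (card (overlap_patterns r j)) * \<eta>"
proof -
  have "raw_moment r \<phi> j P - raw_moment r \<phi> j Q = (\<Sum>p\<in>overlap_patterns r j.
      mean_statistic (fst p) (overlap_function \<phi> r j p) P
      - mean_statistic (fst p) (overlap_function \<phi> r j p) Q)"
    using raw_moment_eq_sum_mean_statistic[OF \<phi> P intP] raw_moment_eq_sum_mean_statistic[OF \<phi> Q intQ]
    by (simp add: sum_subtractf)
  also have "\<bar>\<dots>\<bar> \<le> (\<Sum>p\<in>overlap_patterns r j. \<eta>)"
    by (intro order_trans[OF sum_abs] sum_mono close)
  finally show ?thesis by simp
qed

section \<open>Simultaneous coherency\<close>

text \<open>
  Measurability of \<open>linear_statistic r \<psi>\<close> on configurations comes from a single sample point \<open>\<omega>\<close> at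
  which it is integrable, because all values of the random point process live on the
  same sigma-algebra.
\<close>

lemma measurable_mean_statistic:
  fixes \<psi> :: "(nat \<Rightarrow> 'a::{second_countable_topology, t2_space}) \<Rightarrow> real"
  assumes \<Omega>: "prob_space \<Omega>" and P: "random_point_process \<Omega> A (P n)"
    and ex: "expectations_exist \<Omega> P" and \<psi>: "1 \<le> r" "test_function r \<psi>"
  shows "(\<lambda>\<omega>. mean_statistic r \<psi> (P n \<omega>)) \<in> borel_measurable \<Omega>"
proof -
  interpret prob_space \<Omega> by fact
  have "AE \<omega> in \<Omega>. integrable (P n \<omega>) (linear_statistic r \<psi>)"
    using ex \<psi> unfolding expectations_exist_def by blast
  then obtain G where "G \<subseteq> {\<omega> \<in> space \<Omega>. integrable (P n \<omega>) (linear_statistic r \<psi>)}"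
    and "prob G = 1"
    by (rule AE_E_prob)
  moreover from this(2) have "G \<noteq> {}" by auto
  ultimately obtain \<omega> where \<omega>: "\<omega> \<in> space \<Omega>" "integrable (P n \<omega>) (linear_statistic r \<psi>)"
    by blast
  have "sets (P n \<omega>) = sets (configuration_space A)"
    using random_point_processD[OF P \<omega>(1)] by (simp add: point_process_iff)
  then have "linear_statistic r \<psi> \<in> borel_measurable (configuration_space A)"
    using \<omega>(2) by (simp cong: measurable_cong_sets)
  then have "(\<lambda>M. mean_statistic r \<psi> M) \<in> borel_measurable (prob_algebra (configuration_space A))"
    unfolding mean_statistic_def
    by (rule measurable_compose[OF measurable_prob_algebraD[OF measurable_ident_sets[OF refl]]
          integral_measurable_subprob_algebra])
  then show ?thesis
    using P unfolding random_point_process_def by (rule measurable_compose[rotated])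
qed

text \<open>
  A union bound over the \<open>L\<close> events on which some expectation is off by \<open>\<eta>\<close> or more. These
  events have to be measurable: \<open>measure\<close> assigns \<open>0\<close> to a set that is not measurable, and then
  neither monotonicity nor subadditivity could be used.
\<close>

lemma weakly_coherent_simultaneously:
  fixes \<psi> :: "nat \<Rightarrow> (nat \<Rightarrow> 'a::{second_countable_topology, t2_space}) \<Rightarrow> real"
  assumes \<Omega>: "prob_space \<Omega>"
    and P: "random_point_process \<Omega> A (P n)" "expectations_exist \<Omega> P"
    and Q: "random_point_process \<Omega> A' (Q n)" "expectations_exist \<Omega> Q"
    and coherent: "weakly_coherent \<Omega> P Q N"
    and L: "1 \<le> L" and \<psi>: "\<And>i. i < L \<Longrightarrow> 1 \<le> \<rho> i \<and> test_function (\<rho> i) (\<psi> i)"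
    and \<delta>: "0 < \<delta>" "\<delta> < 1" and \<eta>: "0 < \<eta>"
    and n: "(MAX i\<in>{..<L}. N (\<delta> / real L) \<eta> (\<rho> i) (\<psi> i)) \<le> n"
    and good: "AE \<omega> in \<Omega>. (\<forall>i<L. \<bar>mean_statistic (\<rho> i) (\<psi> i) (P n \<omega>)
        - mean_statistic (\<rho> i) (\<psi> i) (Q n \<omega>)\<bar> < \<eta>) \<longrightarrow> \<not> bad \<omega>"
  shows "measure \<Omega> {\<omega> \<in> space \<Omega>. bad \<omega>} \<le> \<delta>"
proof -
  interpret prob_space \<Omega> by fact
  define E where "E i = {\<omega> \<in> space \<Omega>. \<bar>mean_statistic (\<rho> i) (\<psi> i) (P n \<omega>)
      - mean_statistic (\<rho> i) (\<psi> i) (Q n \<omega>)\<bar> \<ge> \<eta>}" for i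
  have E: "E i \<in> sets \<Omega>" if "i < L" for i
  proof -
    have [measurable]: "(\<lambda>\<omega>. mean_statistic (\<rho> i) (\<psi> i) (P n \<omega>)) \<in> borel_measurable \<Omega>"
      "(\<lambda>\<omega>. mean_statistic (\<rho> i) (\<psi> i) (Q n \<omega>)) \<in> borel_measurable \<Omega>"
      using \<psi>[OF that] measurable_mean_statistic[OF \<Omega> P] measurable_mean_statistic[OF \<Omega> Q] by auto
    show ?thesis unfolding E_def by measurable
  qed
  have "prob (E i) \<le> \<delta> / real L" if i: "i < L" for i
  proof -
    have "N (\<delta> / real L) \<eta> (\<rho> i) (\<psi> i) \<le> n"
      using n i by (intro order_trans[OF Max_ge n]) auto
    moreover have "0 < \<delta> / real L" "\<delta> / real L < 1"
      using \<delta> L by (auto simp: divide_simps)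
    ultimately show ?thesis
      using coherent \<psi>[OF i] \<eta> unfolding weakly_coherent_def E_def by blast
  qed
  then have "(\<Sum>i<L. prob (E i)) \<le> (\<Sum>i<L. \<delta> / real L)"
    by (intro sum_mono) auto
  moreover have "prob (\<Union>i<L. E i) \<le> (\<Sum>i<L. prob (E i))"
    using E by (intro finite_measure_subadditive_finite) auto
  moreover have "prob {\<omega> \<in> space \<Omega>. bad \<omega>} \<le> prob (\<Union>i<L. E i)"
  proof (rule finite_measure_mono_AE)
    show "AE \<omega> in \<Omega>. \<omega> \<in> {\<omega> \<in> space \<Omega>. bad \<omega>} \<longrightarrow> \<omega> \<in> (\<Union>i<L. E i)"
      using good by eventually_elim (force simp: E_def not_less)
  qed (use E in auto)
  ultimately show ?thesis
    using L by simp
qed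

lemma moments_bounded_uniformly:
  fixes m :: "nat \<Rightarrow> nat \<Rightarrow> 'w \<Rightarrow> real"
  assumes "\<And>j. 1 \<le> j \<Longrightarrow> \<exists>B. AE \<omega> in \<Omega>. \<forall>n. \<bar>m j n \<omega>\<bar> \<le> B"
  shows "\<exists>B\<ge>1. AE \<omega> in \<Omega>. \<forall>j\<in>{1..d}. \<forall>n. \<bar>m j n \<omega>\<bar> \<le> B"
proof -
  obtain b where b: "\<And>j. 1 \<le> j \<Longrightarrow> AE \<omega> in \<Omega>. \<forall>n. \<bar>m j n \<omega>\<bar> \<le> b j"
    using assms by metis
  define B where "B = 1 + (\<Sum>j\<in>{1..d}. \<bar>b j\<bar>)"
  have "b j \<le> B" if "j \<in> {1..d}" for j
    using member_le_sum[OF that, of "\<lambda>j. \<bar>b j\<bar>"] by (simp add: B_def)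
  then have "AE \<omega> in \<Omega>. \<forall>n. \<bar>m j n \<omega>\<bar> \<le> B" if "j \<in> {1..d}" for j
    using b[of j] that by (auto elim!: eventually_mono intro: order_trans)
  then have "AE \<omega> in \<Omega>. \<forall>j\<in>{1..d}. \<forall>n. \<bar>m j n \<omega>\<bar> \<le> B"
    by (subst AE_finite_all) auto
  moreover have "1 \<le> B"
    by (simp add: B_def sum_nonneg)
  ultimately show ?thesis by blast
qed

section \<open>Coherency of moments\<close>

theorem theorem3p3:
  fixes \<phi> :: "(nat \<Rightarrow> 'a::{second_countable_topology, t2_space}) \<Rightarrow> real"
    and r k :: nat
  assumes "locally_compact_space (euclidean :: 'a topology)"
    and "1 \<le> r" and "1 \<le> k"
    and "test_function r \<phi>"
  shows "\<exists>(L::nat) (\<rho> :: nat \<Rightarrow> nat) (\<psi> :: nat \<Rightarrow> (nat \<Rightarrow> 'a) \<Rightarrow> real) (s::real).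
    1 \<le> L \<and> (\<forall>i<L. 1 \<le> \<rho> i \<and> test_function (\<rho> i) (\<psi> i)) \<and> 0 < s \<and>
    (\<forall>(\<Omega> :: 'w measure) (X :: nat \<Rightarrow> 'a set) (Y :: nat \<Rightarrow> 'a set)
       (P :: nat \<Rightarrow> 'w \<Rightarrow> 'a set measure) (Q :: nat \<Rightarrow> 'w \<Rightarrow> 'a set measure).
       prob_space \<Omega> \<longrightarrow>
       (\<forall>n. random_point_process \<Omega> (X n) (P n)) \<longrightarrow>
       (\<forall>n. random_point_process \<Omega> (Y n) (Q n)) \<longrightarrow>
       expectations_exist \<Omega> P \<longrightarrow> expectations_exist \<Omega> Q \<longrightarrow>
       (\<forall>N. weakly_coherent \<Omega> P Q N \<longrightarrow>
          (\<forall>\<delta> \<epsilon> n. 0 < \<delta> \<longrightarrow> \<delta> < 1 \<longrightarrow> 0 < \<epsilon> \<longrightarrow>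
             (MAX i\<in>{..<L}. N (\<delta> / real L) (\<epsilon> / s) (\<rho> i) (\<psi> i)) \<le> n \<longrightarrow>
             measure \<Omega> {\<omega> \<in> space \<Omega>.
               \<bar>raw_moment r \<phi> k (P n \<omega>) - raw_moment r \<phi> k (Q n \<omega>)\<bar> \<ge> \<epsilon>} \<le> \<delta>)) \<and>
       ((\<forall>j\<ge>1. \<exists>M. AE \<omega> in \<Omega>. \<forall>n. \<bar>raw_moment r \<phi> j (Q n \<omega>)\<bar> \<le> M) \<longrightarrow>
          (\<exists>s'>0. \<forall>N. weakly_coherent \<Omega> P Q N \<longrightarrow>
             (\<forall>\<delta> \<epsilon> n. 0 < \<delta> \<longrightarrow> \<delta> < 1 \<longrightarrow> 0 < \<epsilon> \<longrightarrow>
                (MAX i\<in>{..<L}. N (\<delta> / real L) (\<epsilon> / s') (\<rho> i) (\<psi> i)) \<le> n \<longrightarrow>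
                measure \<Omega> {\<omega> \<in> space \<Omega>.
                  \<bar>central_moment r \<phi> k (P n \<omega>) - central_moment r \<phi> k (Q n \<omega>)\<bar> \<ge> \<epsilon>} \<le> \<delta>))))"
proof -
  note r = assms(2) and k = assms(3) and \<phi> = assms(4)
  \<comment> \<open>One family serves both claims, hence all the orders up to \<open>2k\<close>.\<close>
  define I where "I = (SIGMA j:{1..2 * k}. overlap_patterns r j)"
  define L where "L = card I"
  have finI: "finite I"
    by (simp add: I_def finite_overlap_patterns)
  have "I \<noteq> {}"
    using overlap_patterns_nonempty[of r] k by (force simp: I_def)
  then have L: "1 \<le> L"
    using finI by (simp add: L_def Suc_le_eq card_gt_0_iff)
  obtain e where e: "bij_betw e {..<L} I"
    using ex_bij_betw_nat_finite[OF finI] by (auto simp: L_def atLeast0LessThan)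
  define \<rho> where "\<rho> i = fst (snd (e i))" for i
  define \<psi> where "\<psi> i = overlap_function \<phi> r (fst (e i)) (snd (e i))" for i
  have \<psi>: "1 \<le> \<rho> i \<and> test_function (\<rho> i) (\<psi> i)" if "i < L" for i
  proof -
    have "e i \<in> I"
      using e that by (auto simp: bij_betw_def)
    then have "snd (e i) \<in> overlap_patterns r (fst (e i))" "1 \<le> fst (e i)"
      by (auto simp: I_def)
    then show ?thesis
      unfolding \<rho>_def \<psi>_def
      using overlap_patterns_arity[OF _ r] test_function_overlap_function[OF \<phi>] by blast
  qed
  have index: "\<exists>i<L. \<rho> i = fst p \<and> \<psi> i = overlap_function \<phi> r j p"
    if "1 \<le> j" "j \<le> 2 * k" "p \<in> overlap_patterns r j" for j p
  proof -
    have "(j, p) \<in> e ` {..<L}"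
      using e that by (auto simp: bij_betw_def I_def)
    then obtain i where "i < L" "e i = (j, p)"
      by auto
    then show ?thesis
      by (intro exI[of _ i]) (simp add: \<rho>_def \<psi>_def)
  qed
  have card_le: "card (overlap_patterns r j) \<le> L" if "1 \<le> j" "j \<le> 2 * k" for j
  proof -
    have "card (overlap_patterns r j) = card (Pair j ` overlap_patterns r j)"
      by (simp add: card_image inj_on_def)
    also have "\<dots> \<le> L"
      unfolding L_def using finI that by (intro card_mono) (auto simp: I_def)
    finally show ?thesis .
  qed
  show ?thesis
  proof (intro exI[of _ L] exI[of _ \<rho>] exI[of _ \<psi>] exI[of _ "2 * real L"] conjI, goal_cases)
    case 4
    show ?case
    proof (intro allI impI, goal_cases)
      case (1 \<Omega> X Y P Q)
      then have \<Omega>: "prob_space \<Omega>"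
        and P: "\<And>n. random_point_process \<Omega> (X n) (P n)" "expectations_exist \<Omega> P"
        and Q: "\<And>n. random_point_process \<Omega> (Y n) (Q n)" "expectations_exist \<Omega> Q"
        by auto
      define close where "close \<eta> n \<omega> \<longleftrightarrow> (\<forall>i<L. \<bar>mean_statistic (\<rho> i) (\<psi> i) (P n \<omega>)
          - mean_statistic (\<rho> i) (\<psi> i) (Q n \<omega>)\<bar> < \<eta>)" for \<eta> n \<omega>
      \<comment> \<open>The sample points at which all integrals below are genuine expectations.\<close>
      define regular where "regular n \<omega> \<longleftrightarrow> point_process (X n) (P n \<omega>) \<and> point_process (Y n) (Q n \<omega>)
          \<and> (\<forall>i<L. integrable (P n \<omega>) (linear_statistic (\<rho> i) (\<psi> i))
                \<and> integrable (Q n \<omega>) (linear_statistic (\<rho> i) (\<psi> i)))" for n \<omega>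
      have reg: "AE \<omega> in \<Omega>. regular n \<omega>" for n
      proof -
        have "AE \<omega> in \<Omega>. integrable (P n \<omega>) (linear_statistic (\<rho> i) (\<psi> i))
            \<and> integrable (Q n \<omega>) (linear_statistic (\<rho> i) (\<psi> i))" if "i \<in> {..<L}" for i
          using \<psi>[of i] that P(2) Q(2) unfolding expectations_exist_def by auto
        then have "AE \<omega> in \<Omega>. \<forall>i\<in>{..<L}. integrable (P n \<omega>) (linear_statistic (\<rho> i) (\<psi> i))
            \<and> integrable (Q n \<omega>) (linear_statistic (\<rho> i) (\<psi> i))"
          by (subst AE_finite_all) auto
        with AE_space show ?thesis
          by eventually_elim
             (use random_point_processD[OF P(1)] random_point_processD[OF Q(1)] in \<open>auto simp: regular_def\<close>)
      qed
      have integrable_power: "integrable (P n \<omega>) (\<lambda>S. linear_statistic r \<phi> S ^ j) \<and>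
          integrable (Q n \<omega>) (\<lambda>S. linear_statistic r \<phi> S ^ j)"
        if "regular n \<omega>" "1 \<le> j" "j \<le> 2 * k" for n \<omega> j
      proof -
        have "integrable (P n \<omega>) (linear_statistic (fst p) (overlap_function \<phi> r j p)) \<and>
            integrable (Q n \<omega>) (linear_statistic (fst p) (overlap_function \<phi> r j p))"
          if p: "p \<in> overlap_patterns r j" for p
          using index[OF \<open>1 \<le> j\<close> \<open>j \<le> 2 * k\<close> p] \<open>regular n \<omega>\<close> by (metis regular_def)
        then show ?thesis
          using \<open>regular n \<omega>\<close> integrable_linear_statistic_power[OF \<phi>] unfolding regular_def by blast
      qed
      have raw: "\<bar>raw_moment r \<phi> j (P n \<omega>) - raw_moment r \<phi> j (Q n \<omega>)\<bar> \<le> real L * \<eta>"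
        if "regular n \<omega>" "close \<eta> n \<omega>" "1 \<le> j" "j \<le> 2 * k" "0 < \<eta>" for n \<omega> j \<eta>
      proof -
        have *: "integrable (P n \<omega>) (linear_statistic (fst p) (overlap_function \<phi> r j p)) \<and>
            integrable (Q n \<omega>) (linear_statistic (fst p) (overlap_function \<phi> r j p)) \<and>
            \<bar>mean_statistic (fst p) (overlap_function \<phi> r j p) (P n \<omega>)
             - mean_statistic (fst p) (overlap_function \<phi> r j p) (Q n \<omega>)\<bar> < \<eta>"
          if p: "p \<in> overlap_patterns r j" for p
          using index[OF \<open>1 \<le> j\<close> \<open>j \<le> 2 * k\<close> p] \<open>regular n \<omega>\<close> \<open>close \<eta> n \<omega>\<close>
          by (metis regular_def close_def)
        have "\<bar>raw_moment r \<phi> j (P n \<omega>) - raw_moment r \<phi> j (Q n \<omega>)\<bar>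
            \<le> real (card (overlap_patterns r j)) * \<eta>"
          using \<open>regular n \<omega>\<close> *
          by (intro raw_moment_diff_le[OF \<phi>, of "X n" _ "Y n"]) (auto simp: regular_def less_imp_le)
        also have "\<dots> \<le> real L * \<eta>"
          using card_le[OF \<open>1 \<le> j\<close> \<open>j \<le> 2 * k\<close>] \<open>0 < \<eta>\<close> by (intro mult_right_mono) auto
        finally show ?thesis .
      qed
      show ?case
      proof (intro conjI allI impI, goal_cases)
        case (1 N \<delta> \<epsilon> n)
        \<comment> \<open>The factor \<open>2\<close> makes the final estimate strict, as the complement of \<open>\<ge> \<epsilon>\<close> requires.\<close>
        let ?\<eta> = "\<epsilon> / (2 * real L)"
        have \<eta>: "0 < ?\<eta>" "real L * ?\<eta> = \<epsilon> / 2"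
          using 1 L by auto
        show ?case
        proof (rule weakly_coherent_simultaneously[where \<eta> = ?\<eta> and L = L and \<rho> = \<rho> and \<psi> = \<psi>,
              OF \<Omega> P Q 1(1) L \<psi> 1(2,3) \<eta>(1) 1(5), folded close_def])
          show "AE \<omega> in \<Omega>. close ?\<eta> n \<omega> \<longrightarrow>
              \<not> \<epsilon> \<le> \<bar>raw_moment r \<phi> k (P n \<omega>) - raw_moment r \<phi> k (Q n \<omega>)\<bar>"
            using reg[of n]
          proof eventually_elim
            case (elim \<omega>)
            show ?case
              using raw[OF elim _ k _ \<eta>(1)] \<eta>(2) 1(4) by fastforce
          qed
        qed
      next
        case 2
        then obtain B where B: "1 \<le> B"
          and bound: "AE \<omega> in \<Omega>. \<forall>j\<in>{1..2 * k}. \<forall>n. \<bar>raw_moment r \<phi> j (Q n \<omega>)\<bar> \<le> B"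
          using moments_bounded_uniformly[of "\<lambda>j n \<omega>. raw_moment r \<phi> j (Q n \<omega>)" \<Omega> "2 * k"] by blast
        define C where "C = central_moment_modulus k (B + 1)"
        have C: "0 < C"
          using B by (simp add: C_def central_moment_modulus_pos)
        show ?case
        proof (intro exI[of _ "2 * real L * C"] conjI allI impI, goal_cases)
          case 1
          show ?case using L C by simp
        next
          case (2 N \<delta> \<epsilon> n)
          let ?\<eta> = "\<epsilon> / (2 * real L * C)"
          have \<eta>: "0 < ?\<eta>" "0 < real L * ?\<eta>" "C * (real L * ?\<eta>) = \<epsilon> / 2"
            using 2 L C by auto
          show ?case
          proof (rule weakly_coherent_simultaneously[where \<eta> = ?\<eta> and L = L and \<rho> = \<rho> and \<psi> = \<psi>,
                OF \<Omega> P Q 2(1) L \<psi> 2(2,3) \<eta>(1) 2(5), folded close_def])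
            show "AE \<omega> in \<Omega>. close ?\<eta> n \<omega> \<longrightarrow>
                \<not> \<epsilon> \<le> \<bar>central_moment r \<phi> k (P n \<omega>) - central_moment r \<phi> k (Q n \<omega>)\<bar>"
              using reg[of n] bound
            proof eventually_elim
              case (elim \<omega>)
              have PQ: "prob_space (P n \<omega>)" "prob_space (Q n \<omega>)"
                using elim(1) by (auto simp: regular_def point_process_iff)
              have int: "integrable (P n \<omega>) (\<lambda>S. linear_statistic r \<phi> S ^ j)"
                "integrable (Q n \<omega>) (\<lambda>S. linear_statistic r \<phi> S ^ j)" if "j \<le> 2 * k" for j
                using integrable_power[OF elim(1), of j] that PQ[THEN prob_space.finite_measure]
                by (cases "j = 0"; auto simp: finite_measure.integrable_const)+
              have le_B: "\<bar>raw_moment r \<phi> j (Q n \<omega>)\<bar> \<le> B" if "j \<le> 2 * k" for j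
                using elim(2) that B prob_space.prob_space[OF PQ(2)]
                by (cases "j = 0") (auto simp: raw_moment_def)
              show ?case
              proof
                assume cl: "close ?\<eta> n \<omega>"
                have "\<bar>central_moment r \<phi> k (P n \<omega>) - central_moment r \<phi> k (Q n \<omega>)\<bar>
                    \<le> C * (real L * ?\<eta>)"
                  unfolding C_def
                  by (rule central_moment_diff_le[OF PQ k int le_B])
                     (use raw[OF elim(1) cl] \<eta> in \<open>auto simp: C_def\<close>)
                then show "\<not> \<epsilon> \<le> \<bar>central_moment r \<phi> k (P n \<omega>) - central_moment r \<phi> k (Q n \<omega>)\<bar>"
                  using \<eta>(3) 2(4) by linarith
              qed
            qed
          qed
        qed
      qed
    qed
  qed (use L \<psi> in auto)
qed

end
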